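(* Let $A = A_0+A_1\mathbf{i}+A_2\mathbf{j}+A_3\mathbf{k} \in \mathbb{Q}_{\mathbb{R}}^{m\times n}$, $B = B_0+B_1\mathbf{i}+B_2\mathbf{j}+B_3\mathbf{k}\in \mathbb{Q}_{\mathbb{R}}^{m\times d}$, $C = C_0+C_1\mathbf{i}+C_2\mathbf{j}+C_3\mathbf{k} \in \mathbb{Q}_{\mathbb{R}}^{p\times n}$, $D = D_0+D_1\mathbf{i}+D_2\mathbf{j}+D_3\mathbf{k} \in \mathbb{Q}_{\mathbb{R}}^{p\times d}$, where $A_l,B_l,C_l,D_l$ ($l=0,1,2,3$) are real matrices. Assume $m\ge n+d$ and that $C^R_c\in\mathbb{R}^{4p\times n}$ has full row rank. Consider the reduced biquaternion equality constrained least squares (RBLSE) problem over real matrices $$\min_{X\in\mathbb{R}^{n\times d}}\|AX-B\|_F\quad\text{subject to}\quad CX=D \qquad (\mathrm{I})$$ and the real equality constrained least squares (LSE) problem $$\min_{X\in\mathbb{R}^{n\times d}}\|A^R_cX-B^R_c\|_F\quad\text{subject to}\quad C^R_cX=D^R_c. \qquad (\mathrm{II})$$ Let the QR factorization of $(C^R_c)^T$ be $$(C^R_c)^T=\bar Q\begin{bmatrix}\bar R\\0\end{bmatrix},$$ where $\bar Q\in\mathbb{R}^{n\times n}$ is orthogonal and $\bar R\in\mathbb{R}^{4p\times 4p}$ is nonsingular upper triangular, and partition $$A^R_c\bar Q=[\bar P_1,\bar P_2],\qquad \bar P_1\in\mathbb{R}^{4m\times 4p},\quad \bar P_2\in\mathbb{R}^{4m\times(n-4p)}.$$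 Let $X\in\mathbb{R}^{n\times d}$. Then $X$ is a (real) solution of the RBLSE problem (I) if and only if $X$ solves the real LSE problem (II). In this scenario, the unique solution $X$ with minimum norm is $$X=\bar Q\begin{bmatrix}(\bar R^T)^{-1}D^R_c\\ \bar P_2^{\dagger}\bigl(B^R_c-\bar P_1(\bar R^T)^{-1}D^R_c\bigr)\end{bmatrix}.$$
   Context: Reduced biquaternions: $\mathbb{Q}_{\mathbb{R}}$ is the set of elements $\zeta=p_0+p_1\mathbf{i}+p_2\mathbf{j}+p_3\mathbf{k}$ with $p_l\in\mathbb{R}$, with commutative multiplication given by $\mathbf{i}^2=\mathbf{k}^2=-1$, $\mathbf{j}^2=1$, $\mathbf{i}\mathbf{j}=\mathbf{j}\mathbf{i}=\mathbf{k}$, $\mathbf{j}\mathbf{k}=\mathbf{k}\mathbf{j}=\mathbf{i}$, $\mathbf{k}\mathbf{i}=\mathbf{i}\mathbf{k}=-\mathbf{j}$. The norm is $\|\zeta\|=\sqrt{p_0^2+p_1^2+p_2^2+p_3^2}$. $\mathbb{Q}_{\mathbb{R}}^{m\times n}$ is the set of $m\times n$ matrices over $\mathbb{Q}_{\mathbb{R}}$; real matrices are regarded as elements of it. For $M=(m_{st})\in\mathbb{Q}_{\mathbb{R}}^{m\times n}$ the Frobenius norm is $\|M\|_F=\sqrt{\sum_{s,t}\|m_{st}\|^2}$; for real matrices $\|\cdot\|_F$ is the usual Frobenius norm. For $M=M_0+M_1\mathbf{i}+M_2\mathbf{j}+M_3\mathbf{k}\in\mathbb{Q}_{\mathbb{R}}^{m\times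 n}$ with $M_l\in\mathbb{R}^{m\times n}$, define $M^R_c=[M_0^T,M_1^T,M_2^T,M_3^T]^T\in\mathbb{R}^{4m\times n}$ (the first block column of the real representation of $M$). $[P,Q]$ denotes horizontal concatenation and $P^{\dagger}$ the Moore–Penrose inverse. "Minimum norm" refers to the Frobenius norm among all solutions. *)

theory Defs
  imports
    Complex_Main
    "Jordan_Normal_Form.Gauss_Jordan_Elimination"
    "Jordan_Normal_Form.DL_Rank"
begin

section \<open>Reduced biquaternions\<close>

datatype rbq = Rbq (Rb0: real) (Rb1: real) (Rb2: real) (Rb3: real)

lemma rbq_eq_iff:
  "x = y \<longleftrightarrow> Rb0 x = Rb0 y \<and> Rb1 x = Rb1 y \<and> Rb2 x = Rb2 y \<and> Rb3 x = Rb3 y"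
  by (cases x; cases y) simp

instantiation rbq :: real_algebra_1
begin

definition zero_rbq :: rbq where "0 = Rbq 0 0 0 0"

definition one_rbq :: rbq where "1 = Rbq 1 0 0 0"

definition plus_rbq :: "rbq \<Rightarrow> rbq \<Rightarrow> rbq" where
  "x + y = Rbq (Rb0 x + Rb0 y) (Rb1 x + Rb1 y) (Rb2 x + Rb2 y) (Rb3 x + Rb3 y)"

definition minus_rbq :: "rbq \<Rightarrow> rbq \<Rightarrow> rbq" where
  "x - y = Rbq (Rb0 x - Rb0 y) (Rb1 x - Rb1 y) (Rb2 x - Rb2 y) (Rb3 x - Rb3 y)"

definition uminus_rbq :: "rbq \<Rightarrow> rbq" where
  "- x = Rbq (- Rb0 x) (- Rb1 x) (- Rb2 x) (- Rb3 x)"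

definition scaleR_rbq :: "real \<Rightarrow> rbq \<Rightarrow> rbq" where
  "r *\<^sub>R x = Rbq (r * Rb0 x) (r * Rb1 x) (r * Rb2 x) (r * Rb3 x)"

text \<open>The bilinear extension of the multiplication table proved in
  \<open>rbq_multiplication_table\<close> below.\<close>

definition times_rbq :: "rbq \<Rightarrow> rbq \<Rightarrow> rbq" where
  "x * y = Rbq
     (Rb0 x * Rb0 y - Rb1 x * Rb1 y + Rb2 x * Rb2 y - Rb3 x * Rb3 y)
     (Rb0 x * Rb1 y + Rb1 x * Rb0 y + Rb2 x * Rb3 y + Rb3 x * Rb2 y)
     (Rb0 x * Rb2 y + Rb2 x * Rb0 y - Rb1 x * Rb3 y - Rb3 x * Rb1 y)
     (Rb0 x * Rb3 y + Rb3 x * Rb0 y + Rb1 x * Rb2 y + Rb2 x * Rb1 y)"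

instance
  by standard
    (simp_all add: rbq_eq_iff zero_rbq_def one_rbq_def plus_rbq_def minus_rbq_def
      uminus_rbq_def scaleR_rbq_def times_rbq_def algebra_simps)

end

instance rbq :: comm_ring_1
  by standard (simp_all add: rbq_eq_iff one_rbq_def plus_rbq_def times_rbq_def algebra_simps)

definition rbq_i :: rbq where "rbq_i = Rbq 0 1 0 0"
definition rbq_j :: rbq where "rbq_j = Rbq 0 0 1 0"
definition rbq_k :: rbq where "rbq_k = Rbq 0 0 0 1"

lemma rbq_multiplication_table:
  "rbq_i * rbq_i = -1" "rbq_k * rbq_k = -1" "rbq_j * rbq_j = 1"
  "rbq_i * rbq_j = rbq_k" "rbq_j * rbq_k = rbq_i" "rbq_k * rbq_i = - rbq_j"
  by (simp_all add: rbq_eq_iff rbq_i_def rbq_j_def rbq_k_def one_rbq_def uminus_rbq_def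
      times_rbq_def)

lemma rbq_decomposition:
  "x = of_real (Rb0 x) + of_real (Rb1 x) * rbq_i + of_real (Rb2 x) * rbq_j
       + of_real (Rb3 x) * rbq_k"
  by (simp add: rbq_eq_iff of_real_def rbq_i_def rbq_j_def rbq_k_def one_rbq_def
      plus_rbq_def times_rbq_def scaleR_rbq_def)

instantiation rbq :: real_normed_vector
begin

definition norm_rbq :: "rbq \<Rightarrow> real" where
  "norm x = sqrt ((Rb0 x)\<^sup>2 + (Rb1 x)\<^sup>2 + (Rb2 x)\<^sup>2 + (Rb3 x)\<^sup>2)"

definition sgn_rbq :: "rbq \<Rightarrow> rbq" where "sgn (x::rbq) = x /\<^sub>R norm x"

definition dist_rbq :: "rbq \<Rightarrow> rbq \<Rightarrow> real" where "dist (x::rbq) y = norm (x - y)"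

definition uniformity_rbq :: "(rbq \<times> rbq) filter" where
  "(uniformity :: (rbq \<times> rbq) filter) = (INF e\<in>{0 <..}. principal {(x, y). dist x y < e})"

definition open_rbq :: "rbq set \<Rightarrow> bool" where
  "open (U :: rbq set) \<longleftrightarrow> (\<forall>x\<in>U. eventually (\<lambda>(x', y). x' = x \<longrightarrow> y \<in> U) uniformity)"

instance
proof
  fix r :: real and x y :: rbq and S :: "rbq set"
  show "norm x = 0 \<longleftrightarrow> x = 0"
    by (auto simp: norm_rbq_def rbq_eq_iff zero_rbq_def add_nonneg_eq_0_iff)
  show "norm (r *\<^sub>R x) = \<bar>r\<bar> * norm x"
    by (simp add: norm_rbq_def scaleR_rbq_def power_mult_distrib real_sqrt_mult
        flip: distrib_left)
  have split: "norm z = sqrt ((sqrt ((Rb0 z)\<^sup>2 + (Rb1 z)\<^sup>2))\<^sup>2 + (sqrt ((Rb2 z)\<^sup>2 + (Rb3 z)\<^sup>2))\<^sup>2)"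
    for z :: rbq
    by (simp add: norm_rbq_def)
  have "norm (x + y) \<le> sqrt ((sqrt ((Rb0 x)\<^sup>2 + (Rb1 x)\<^sup>2) + sqrt ((Rb0 y)\<^sup>2 + (Rb1 y)\<^sup>2))\<^sup>2
      + (sqrt ((Rb2 x)\<^sup>2 + (Rb3 x)\<^sup>2) + sqrt ((Rb2 y)\<^sup>2 + (Rb3 y)\<^sup>2))\<^sup>2)"
    unfolding split plus_rbq_def rbq.sel
    by (intro real_sqrt_le_mono add_mono power_mono real_sqrt_sum_squares_triangle_ineq
        real_sqrt_ge_zero sum_power2_ge_zero)
  also have "\<dots> \<le> norm x + norm y"
    unfolding split by (rule real_sqrt_sum_squares_triangle_ineq)
  finally show "norm (x + y) \<le> norm x + norm y" .
qed (rule sgn_rbq_def dist_rbq_def uniformity_rbq_def open_rbq_def)+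

end


section \<open>Matrices\<close>

definition frobenius_norm :: "'a::real_normed_vector mat \<Rightarrow> real" where
  "frobenius_norm M = sqrt (\<Sum>s<dim_row M. \<Sum>t<dim_col M. (norm (M $$ (s, t)))\<^sup>2)"

text \<open>The embedding of real matrices into the reduced biquaternion matrices.\<close>

abbreviation rbq_of_real_mat :: "real mat \<Rightarrow> rbq mat" where
  "rbq_of_real_mat \<equiv> map_mat of_real"

text \<open>Horizontal concatenation \<open>[P, Q]\<close>, the counterpart of the library's vertical
  concatenation \<open>P @\<^sub>r Q\<close>.\<close>

definition append_cols :: "'a::zero mat \<Rightarrow> 'a mat \<Rightarrow> 'a mat" (infixr \<open>@\<^sub>c\<close> 65) where
  "P @\<^sub>c Q = four_block_mat P Q (0\<^sub>m 0 (dim_col P)) (0\<^sub>m 0 (dim_col Q))"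

text \<open>First block column of the real representation.\<close>

definition real_rep_col :: "rbq mat \<Rightarrow> real mat" where
  "real_rep_col M = map_mat Rb0 M @\<^sub>r map_mat Rb1 M @\<^sub>r map_mat Rb2 M @\<^sub>r map_mat Rb3 M"

lemma rbq_mat_decomposition:
  "M = rbq_of_real_mat (map_mat Rb0 M) + rbq_i \<cdot>\<^sub>m rbq_of_real_mat (map_mat Rb1 M)
     + rbq_j \<cdot>\<^sub>m rbq_of_real_mat (map_mat Rb2 M) + rbq_k \<cdot>\<^sub>m rbq_of_real_mat (map_mat Rb3 M)"
  by (rule eq_matI) (auto simp: mult.commute[of _ "of_real _"] intro: rbq_decomposition)

lemma real_rep_col_carrier [simp, intro]:
  assumes "M \<in> carrier_mat m n"
  shows "real_rep_col M \<in> carrier_mat (4 * m) n"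
proof -
  have "real_rep_col M \<in> carrier_mat (m + (m + (m + m))) n"
    using assms unfolding real_rep_col_def by (intro carrier_append_rows) auto
  moreover have "m + (m + (m + m)) = 4 * m" by simp
  ultimately show ?thesis by simp
qed

definition full_row_rank :: "real mat \<Rightarrow> bool" where
  "full_row_rank M \<longleftrightarrow> vec_space.rank (dim_row M) M = dim_row M"

definition orthogonal_real_mat :: "real mat \<Rightarrow> bool" where
  "orthogonal_real_mat Q \<longleftrightarrow> square_mat Q \<and> inverts_mat (Q\<^sup>T) Q \<and> inverts_mat Q (Q\<^sup>T)"

text \<open>The inverse of a nonsingular square matrix; unspecified otherwise.\<close>

abbreviation inv_mat :: "real mat \<Rightarrow> real mat" where
  "inv_mat M \<equiv> the (mat_inverse M)"

definition is_moore_penrose :: "real mat \<Rightarrow> real mat \<Rightarrow> bool" where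
  "is_moore_penrose P G \<longleftrightarrow> G \<in> carrier_mat (dim_col P) (dim_row P) \<and>
     P * G * P = P \<and> G * P * G = G \<and> (P * G)\<^sup>T = P * G \<and> (G * P)\<^sup>T = G * P"

definition moore_penrose :: "real mat \<Rightarrow> real mat" where
  "moore_penrose P = (THE G. is_moore_penrose P G)"


section \<open>Equality constrained least squares problems\<close>

definition rblse_solution :: "rbq mat \<Rightarrow> rbq mat \<Rightarrow> rbq mat \<Rightarrow> rbq mat \<Rightarrow> real mat \<Rightarrow> bool" where
  "rblse_solution A B C D =
     is_arg_min (\<lambda>X. frobenius_norm (A * rbq_of_real_mat X - B))
       (\<lambda>X. X \<in> carrier_mat (dim_col A) (dim_col B) \<and> C * rbq_of_real_mat X = D)"

definition lse_solution :: "real mat \<Rightarrow> real mat \<Rightarrow> real mat \<Rightarrow> real mat \<Rightarrow> real mat \<Rightarrow> bool" where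
  "lse_solution A B C D =
     is_arg_min (\<lambda>X. frobenius_norm (A * X - B))
       (\<lambda>X. X \<in> carrier_mat (dim_col A) (dim_col B) \<and> C * X = D)"

end

theory Submission
  imports Defs
begin

text \<open>Multiplication by a real matrix acts separately on the four components of a reduced biquaternion
  matrix, so \<open>M \<mapsto> M\<^sup>R\<^sub>c\<close> is an injective isometry that turns (I) into (II). For (II), put
  \<open>X = Q [Y; Z]\<close>: the constraint becomes \<open>R\<^sup>T Y = D\<^sup>R\<^sub>c\<close>, the objective becomes that of the
  unconstrained problem for \<open>P\<^sub>2 Z - E\<close> with \<open>E = B\<^sup>R\<^sub>c - P\<^sub>1 Y\<close>, and the norm of \<open>X\<close> splits by orthogonality of \<open>Q\<close>. With
  \<open>Z\<^sub>0 = P\<^sub>2\<^sup>\<dagger> E\<close>, two applications of Pythagoras show that \<open>Z\<close> is a minimizer iff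
  \<open>P\<^sub>2 (Z - Z\<^sub>0) = 0\<close>, and that then \<open>\<parallel>Z\<parallel>\<^sup>2 = \<parallel>Z\<^sub>0\<parallel>\<^sup>2 + \<parallel>Z - Z\<^sub>0\<parallel>\<^sup>2\<close>.\<close>


section \<open>Matrix algebra\<close>

text \<open>The laws of matrix algebra with their side conditions in terms of dimensions, so that the
  simplifier can discharge them.\<close>

lemma assoc_mult_mat_dim:
  fixes A B C :: "'a::semiring_0 mat"
  shows "dim_col A = dim_row B \<Longrightarrow> dim_col B = dim_row C \<Longrightarrow> A * B * C = A * (B * C)"
  by (rule assoc_mult_mat) auto

lemma transpose_mult_dim:
  fixes A B :: "'a::comm_semiring_0 mat"
  shows "dim_col A = dim_row B \<Longrightarrow> (A * B)\<^sup>T = B\<^sup>T * A\<^sup>T"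
  by (rule transpose_mult) auto

lemma mult_minus_distrib_mat_dim:
  fixes A B C :: "'a::ring mat"
  shows "dim_col A = dim_row B \<Longrightarrow> dim_row B = dim_row C \<Longrightarrow> dim_col B = dim_col C
    \<Longrightarrow> A * (B - C) = A * B - A * C"
  by (rule mult_minus_distrib_mat) auto

lemma minus_mult_distrib_mat_dim:
  fixes A B C :: "'a::ring mat"
  shows "dim_col A = dim_row C \<Longrightarrow> dim_row A = dim_row B \<Longrightarrow> dim_col A = dim_col B
    \<Longrightarrow> (A - B) * C = A * C - B * C"
  by (rule minus_mult_distrib_mat) auto

lemma transpose_minus_dim:
  fixes A B :: "'a::group_add mat"
  shows "dim_row A = dim_row B \<Longrightarrow> dim_col A = dim_col B \<Longrightarrow> (A - B)\<^sup>T = A\<^sup>T - B\<^sup>T"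
  by (rule eq_matI) auto

lemma index_mult_mat_sum:
  fixes A B :: "'a::semiring_0 mat"
  assumes "A \<in> carrier_mat m n" "B \<in> carrier_mat n k" "i < m" "j < k"
  shows "(A * B) $$ (i, j) = (\<Sum>l<n. A $$ (i, l) * B $$ (l, j))"
  using assms by (simp add: scalar_prod_def atLeast0LessThan)

lemma minus_mat_eq_zero_iff:
  fixes A B :: "'a::group_add mat"
  assumes "A \<in> carrier_mat m n" "B \<in> carrier_mat m n"
  shows "A - B = 0\<^sub>m m n \<longleftrightarrow> A = B"
  using assms by (auto simp: mat_eq_iff)

lemmas mat_dim_simps = assoc_mult_mat_dim transpose_mult_dim mult_minus_distrib_mat_dim
  minus_mult_distrib_mat_dim transpose_minus_dim

section \<open>Vertical and horizontal concatenation of matrices\<close>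

lemma append_rows_dim [simp]:
  "dim_row (A @\<^sub>r B) = dim_row A + dim_row B"
  "dim_col (A @\<^sub>r B) = dim_col A"
  by (simp_all add: append_rows_def)

lemma append_rows_index:
  assumes "dim_col A = dim_col B" "i < dim_row A + dim_row B" "j < dim_col A"
  shows "(A @\<^sub>r B) $$ (i, j) = (if i < dim_row A then A $$ (i, j) else B $$ (i - dim_row A, j))"
  using assms by (simp add: append_rows_def)

lemma append_rows_inject:
  assumes "A \<in> carrier_mat r n" "A' \<in> carrier_mat r n" "B \<in> carrier_mat s n" "B' \<in> carrier_mat s n"
  shows "A @\<^sub>r B = A' @\<^sub>r B' \<longleftrightarrow> A = A' \<and> B = B'"
proof
  assume eq: "A @\<^sub>r B = A' @\<^sub>r B'"
  have ent: "(A @\<^sub>r B) $$ (i, j) = (A' @\<^sub>r B') $$ (i, j)" for i j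
    using eq by simp
  have "A = A'"
  proof (rule eq_matI)
    fix i j assume "i < dim_row A'" "j < dim_col A'"
    then show "A $$ (i, j) = A' $$ (i, j)"
      using ent[of i j] assms by (simp add: append_rows_index)
  qed (use assms in auto)
  moreover have "B = B'"
  proof (rule eq_matI)
    fix i j assume "i < dim_row B'" "j < dim_col B'"
    then show "B $$ (i, j) = B' $$ (i, j)"
      using ent[of "r + i" j] assms by (simp add: append_rows_index)
  qed (use assms in auto)
  ultimately show "A = A' \<and> B = B'" ..
qed simp

lemma append_rows_minus:
  fixes A B A' B' :: "'a::group_add mat"
  assumes "A \<in> carrier_mat r n" "A' \<in> carrier_mat r n" "B \<in> carrier_mat s n" "B' \<in> carrier_mat s n"
  shows "(A @\<^sub>r B) - (A' @\<^sub>r B') = (A - A') @\<^sub>r (B - B')"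
  by (rule eq_matI) (use assms in \<open>auto simp: append_rows_index\<close>)

lemma append_rows_mult:
  fixes A B X :: "'a::semiring_0 mat"
  assumes "A \<in> carrier_mat r n" "B \<in> carrier_mat s n" "X \<in> carrier_mat n d"
  shows "(A @\<^sub>r B) * X = (A * X) @\<^sub>r (B * X)"
proof (rule eq_matI)
  fix i j assume ij: "i < dim_row (A * X @\<^sub>r B * X)" "j < dim_col (A * X @\<^sub>r B * X)"
  have "row (A @\<^sub>r B) i = (if i < r then row A i else row B (i - r))"
    by (rule eq_vecI) (use ij assms in \<open>auto simp: append_rows_index\<close>)
  then show "((A @\<^sub>r B) * X) $$ (i, j) = (A * X @\<^sub>r B * X) $$ (i, j)"
    using ij assms by (auto simp: append_rows_index)
qed (use assms in auto)

lemma append_rows_transpose_mult: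
  fixes M N Y Z :: "'a::comm_semiring_0 mat"
  assumes "M \<in> carrier_mat r n" "N \<in> carrier_mat s n" "Y \<in> carrier_mat r d" "Z \<in> carrier_mat s d"
  shows "(M @\<^sub>r N)\<^sup>T * (Y @\<^sub>r Z) = M\<^sup>T * Y + N\<^sup>T * Z"
proof -
  have "(M @\<^sub>r N)\<^sup>T = four_block_mat (M\<^sup>T) (N\<^sup>T) (0\<^sub>m 0 r) (0\<^sub>m 0 s)"
    by (rule eq_matI) (use assms in \<open>auto simp: append_rows_def\<close>)
  \<comment> \<open>Padding by blocks of height or width 0 makes both factors four-block matrices,
    so the block product formula applies.\<close>
  also have "\<dots> * (Y @\<^sub>r Z) =
      four_block_mat (M\<^sup>T * Y + N\<^sup>T * Z) (M\<^sup>T * 0\<^sub>m r 0 + N\<^sup>T * 0\<^sub>m s 0)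
        (0\<^sub>m 0 r * Y + 0\<^sub>m 0 s * Z) (0\<^sub>m 0 r * 0\<^sub>m r 0 + 0\<^sub>m 0 s * 0\<^sub>m s 0)"
    unfolding append_rows_def using assms
    by (subst mult_four_block_mat[of _ n r _ s _ 0]) auto
  also have "\<dots> = M\<^sup>T * Y + N\<^sup>T * Z"
    by (rule eq_matI) (use assms in auto)
  finally show ?thesis .
qed

text \<open>Reduces to the transposed form, since \<open>[M, N]\<close> is the transpose of a stack
  of transposes. It splits \<open>A * Q * (Y @\<^sub>r Z)\<close> along the partition of
  \<open>A * Q\<close>.\<close>

lemma append_cols_mult_append_rows:
  fixes M N Y Z :: "'a::comm_semiring_0 mat"
  assumes "M \<in> carrier_mat n r" "N \<in> carrier_mat n s" "Y \<in> carrier_mat r d" "Z \<in> carrier_mat s d"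
  shows "(M @\<^sub>c N) * (Y @\<^sub>r Z) = M * Y + N * Z"
proof -
  have "M @\<^sub>c N = (M\<^sup>T @\<^sub>r N\<^sup>T)\<^sup>T"
    by (rule eq_matI) (use assms in \<open>auto simp: append_rows_def append_cols_def\<close>)
  then show ?thesis
    using append_rows_transpose_mult[of "M\<^sup>T" r n "N\<^sup>T" s Y d Z] assms by simp
qed

lemma append_rows_split:
  assumes "M \<in> carrier_mat (r + s) n"
  obtains M1 M2 where "M1 \<in> carrier_mat r n" "M2 \<in> carrier_mat s n" "M = M1 @\<^sub>r M2"
proof
  let ?M1 = "mat r n (\<lambda>(i, j). M $$ (i, j))" and ?M2 = "mat s n (\<lambda>(i, j). M $$ (r + i, j))"
  show "?M1 \<in> carrier_mat r n" "?M2 \<in> carrier_mat s n" by auto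
  show "M = ?M1 @\<^sub>r ?M2"
    by (rule eq_matI) (use assms in \<open>auto simp: append_rows_index\<close>)
qed

section \<open>Invertible matrices and their transposes\<close>

lemma inv_mat_mult:
  assumes M: "M \<in> carrier_mat n n" and inv: "invertible_mat M"
  shows "inv_mat M \<in> carrier_mat n n" "M * inv_mat M = 1\<^sub>m n" "inv_mat M * M = 1\<^sub>m n"
proof -
  obtain N where N: "M * N = 1\<^sub>m n" "N * M = 1\<^sub>m (dim_row N)"
    using inv M by (auto simp: invertible_mat_def inverts_mat_def)
  \<comment> \<open>\<open>invertible_mat\<close> does not state the shape of the inverse; it is
    read off from the column counts of the two products.\<close>
  have "dim_col (M * N) = n" "dim_col (N * M) = dim_row N"
    unfolding N by simp_all
  then have "N \<in> carrier_mat n n"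
    using M by auto
  then have "M \<in> Units (ring_mat TYPE(real) n ())"
    using M N by (auto simp: Units_def ring_mat_def)
  then obtain M' where M': "mat_inverse M = Some M'"
    using mat_inverse(1)[OF M] by fastforce
  then show "inv_mat M \<in> carrier_mat n n" "M * inv_mat M = 1\<^sub>m n" "inv_mat M * M = 1\<^sub>m n"
    using mat_inverse(2)[OF M M'] by auto
qed

lemma invertible_mat_transpose:
  fixes M :: "'a::comm_ring_1 mat"
  assumes "invertible_mat M"
  shows "invertible_mat (M\<^sup>T)"
proof -
  obtain N where sq: "dim_col M = dim_row M" and N: "M * N = 1\<^sub>m (dim_row M)" "N * M = 1\<^sub>m (dim_row N)"
    using assms by (auto simp: invertible_mat_def inverts_mat_def)
  have "dim_col (M * N) = dim_row M" "dim_col (N * M) = dim_row N"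
    unfolding N by simp_all
  then have d: "dim_row N = dim_row M" "dim_col N = dim_row M"
    using sq by auto
  have "M\<^sup>T * N\<^sup>T = (N * M)\<^sup>T" "N\<^sup>T * M\<^sup>T = (M * N)\<^sup>T"
    using d sq by (simp_all add: transpose_mult_dim)
  then have "inverts_mat (M\<^sup>T) (N\<^sup>T)" "inverts_mat (N\<^sup>T) (M\<^sup>T)"
    using N d sq by (simp_all add: inverts_mat_def)
  then show ?thesis
    using sq by (auto simp: invertible_mat_def)
qed


section \<open>The Frobenius norm\<close>

lemma frobenius_norm_nonneg: "0 \<le> frobenius_norm M"
  by (simp add: frobenius_norm_def sum_nonneg)

lemma frobenius_norm_sq:
  "(frobenius_norm M)\<^sup>2 = (\<Sum>s<dim_row M. \<Sum>t<dim_col M. (norm (M $$ (s, t)))\<^sup>2)"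
  by (simp add: frobenius_norm_def sum_nonneg)

lemma frobenius_norm_le_iff:
  "frobenius_norm M \<le> frobenius_norm N \<longleftrightarrow> (frobenius_norm M)\<^sup>2 \<le> (frobenius_norm N)\<^sup>2"
  by (simp add: frobenius_norm_nonneg)

lemma frobenius_norm_eq_0_iff:
  assumes "M \<in> carrier_mat m n"
  shows "frobenius_norm M = 0 \<longleftrightarrow> M = 0\<^sub>m m n"
proof -
  have "(frobenius_norm M)\<^sup>2 = 0 \<longleftrightarrow> (\<forall>s<m. \<forall>t<n. M $$ (s, t) = 0)"
    unfolding frobenius_norm_sq using assms
    by (auto simp: sum_nonneg_eq_0_iff sum_nonneg)
  also have "\<dots> \<longleftrightarrow> M = 0\<^sub>m m n"
    using assms by (auto simp: mat_eq_iff)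
  finally show ?thesis by simp
qed

text \<open>The right-hand side is the trace of the Gram matrix, so norm identities can be derived
  by matrix algebra.\<close>

lemma frobenius_norm_sq_eq_trace:
  fixes M :: "real mat"
  shows "(frobenius_norm M)\<^sup>2 = (\<Sum>t<dim_col M. (M\<^sup>T * M) $$ (t, t))"
proof -
  have "(frobenius_norm M)\<^sup>2 = (\<Sum>t<dim_col M. \<Sum>s<dim_row M. (M $$ (s, t))\<^sup>2)"
    unfolding frobenius_norm_sq by (subst sum.swap) simp
  also have "\<dots> = (\<Sum>t<dim_col M. (M\<^sup>T * M) $$ (t, t))"
    by (intro sum.cong) (auto simp: scalar_prod_def power2_eq_square atLeast0LessThan)
  finally show ?thesis .
qed

section \<open>Gram matrices and orthogonality\<close>

lemma gram_eq_zero_imp_zero: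
  fixes M :: "real mat"
  assumes "M \<in> carrier_mat m n" "M\<^sup>T * M = 0\<^sub>m n n"
  shows "M = 0\<^sub>m m n"
proof -
  have "(frobenius_norm M)\<^sup>2 = 0"
    using assms by (simp add: frobenius_norm_sq_eq_trace)
  then show ?thesis
    using frobenius_norm_eq_0_iff[OF assms(1)] by simp
qed

text \<open>The Gram matrix of \<open>A * M\<close> has \<open>A\<^sup>T * (A * M)\<close> as a
  factor, so it vanishes too. This is how \<open>A\<^sup>T\<close> is cancelled on the left.\<close>

lemma gram_mult_eq_zero_imp_zero:
  fixes A M :: "real mat"
  assumes A: "A \<in> carrier_mat m n" and M: "M \<in> carrier_mat n k" and 0: "A\<^sup>T * (A * M) = 0\<^sub>m n k"
  shows "A * M = 0\<^sub>m m k"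
proof (rule gram_eq_zero_imp_zero)
  have "(A * M)\<^sup>T * (A * M) = M\<^sup>T * (A\<^sup>T * (A * M))"
    using A M by (simp add: mat_dim_simps)
  then show "(A * M)\<^sup>T * (A * M) = 0\<^sub>m k k"
    using 0 M by simp
qed (use A M in auto)

text \<open>Both mixed terms in the Gram matrix of \<open>M + N\<close> vanish, one by hypothesis
  and the other as its transpose.\<close>

lemma frobenius_norm_pythagoras:
  fixes M N :: "real mat"
  assumes M: "M \<in> carrier_mat m n" and N: "N \<in> carrier_mat m n" and orth: "M\<^sup>T * N = 0\<^sub>m n n"
  shows "(frobenius_norm (M + N))\<^sup>2 = (frobenius_norm M)\<^sup>2 + (frobenius_norm N)\<^sup>2"
proof -
  have "N\<^sup>T * M = (M\<^sup>T * N)\<^sup>T"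
    using M N by (simp add: mat_dim_simps)
  then have "N\<^sup>T * M = 0\<^sub>m n n"
    by (simp add: orth)
  moreover have "(M + N)\<^sup>T * (M + N) = (M\<^sup>T * M + N\<^sup>T * M) + (M\<^sup>T * N + N\<^sup>T * N)"
    using M N transpose_add[OF M N]
    by (simp add: add_mult_distrib_mat[of _ n m] mult_add_distrib_mat[of _ n m _ n])
  ultimately have "(M + N)\<^sup>T * (M + N) = M\<^sup>T * M + N\<^sup>T * N"
    using M N orth by simp
  then show ?thesis
    using M N by (simp add: frobenius_norm_sq_eq_trace sum.distrib)
qed

lemma frobenius_norm_orthogonal_mult:
  fixes Q X :: "real mat"
  assumes "Q \<in> carrier_mat n n" "Q\<^sup>T * Q = 1\<^sub>m n" "X \<in> carrier_mat n d"
  shows "frobenius_norm (Q * X) = frobenius_norm X"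
proof -
  have "(Q * X)\<^sup>T * (Q * X) = X\<^sup>T * ((Q\<^sup>T * Q) * X)"
    using assms(1,3) by (simp add: mat_dim_simps)
  then have "(frobenius_norm (Q * X))\<^sup>2 = (frobenius_norm X)\<^sup>2"
    using assms by (simp add: frobenius_norm_sq_eq_trace)
  then show ?thesis
    by (simp add: frobenius_norm_nonneg power2_eq_iff_nonneg)
qed

lemma sum_lessThan_add: "sum f {..<a + b :: nat} = sum f {..<a} + (\<Sum>i<b. f (a + i))"
  for f :: "nat \<Rightarrow> 'a::comm_monoid_add"
  by (induction b) (simp_all add: add.assoc)

lemma frobenius_norm_append_rows:
  assumes "A \<in> carrier_mat r n" "B \<in> carrier_mat s n"
  shows "(frobenius_norm (A @\<^sub>r B))\<^sup>2 = (frobenius_norm A)\<^sup>2 + (frobenius_norm B)\<^sup>2"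
  using assms by (simp add: frobenius_norm_sq sum_lessThan_add append_rows_index)


section \<open>The Moore--Penrose inverse\<close>

text \<open>For the reduced row echelon form, let \<open>G\<close> map the \<open>i\<close>-th unit vector to the unit vector of
  the \<open>i\<close>-th pivot column.\<close>

lemma generalized_inverse_exists:
  fixes A :: "'a::field mat"
  assumes A: "A \<in> carrier_mat m n"
  obtains G where "G \<in> carrier_mat n m" "A * G * A = A"
proof -
  define E where "E = gauss_jordan_single A"
  note gj = gauss_jordan_single[OF A E_def[symmetric]]
  have E: "E \<in> carrier_mat m n" by (rule gj(2))
  obtain P P' where P: "E = P * A" "P \<in> carrier_mat m m" "P' \<in> carrier_mat m m" "P' * P = 1\<^sub>m m"
    using gj(4) by auto
  obtain f where f: "pivot_fun E f n"
    using gj(3) E by (auto simp: row_echelon_form_def)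
  have dE: "dim_row E = m" using E by simp
  note piv = pivot_funD[OF dE f]
  \<comment> \<open>For a zero row \<open>i\<close> of \<open>E\<close> the pivot function takes the
    value \<open>n\<close>, which is not a row index of \<open>H\<close>, so column \<open>i\<close>
    of \<open>H\<close> is zero.\<close>
  define H :: "'a mat" where "H = mat n m (\<lambda>(j, i). if j = f i then 1 else 0)"
  have H: "H \<in> carrier_mat n m" by (simp add: H_def)
  have EH: "(E * H) $$ (k, i) = (if k = i \<and> f i < n then 1 else 0)" if "k < m" "i < m" for k i
  proof -
    have "(E * H) $$ (k, i) = (\<Sum>j<n. E $$ (k, j) * (if j = f i then 1 else 0))"
      using that index_mult_mat_sum[OF E H] by (simp add: H_def)
    also have "\<dots> = (if f i < n then E $$ (k, f i) else 0)"
      by (simp add: if_distrib[of "\<lambda>x. _ * x"] cong: if_cong)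
    also have "\<dots> = (if k = i \<and> f i < n then 1 else 0)"
      using piv(4,5) that by auto
    finally show ?thesis .
  qed
  \<comment> \<open>\<open>E * H\<close> is the diagonal projection onto the rows with a pivot, and
    the remaining rows of \<open>E\<close> are zero.\<close>
  have "E * H * E = E"
  proof (rule eq_matI)
    fix i j assume ij: "i < dim_row E" "j < dim_col E"
    have "(E * H * E) $$ (i, j) = (\<Sum>k<m. (E * H) $$ (i, k) * E $$ (k, j))"
      by (rule index_mult_mat_sum) (use ij E H in auto)
    also have "\<dots> = (\<Sum>k<m. if k = i then (if f i < n then E $$ (i, j) else 0) else 0)"
      using ij E by (intro sum.cong) (auto simp: EH)
    also have "\<dots> = (if f i < n then E $$ (i, j) else 0)"
      using ij E by simp
    also have "\<dots> = E $$ (i, j)"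
      using piv(1,2)[of i] ij E by (cases "f i = n") fastforce+
    finally show "(E * H * E) $$ (i, j) = E $$ (i, j)" .
  qed (use E H in auto)
  \<comment> \<open>Cancelling the invertible \<open>P\<close> on the left carries the result from
    \<open>E\<close> back to \<open>A\<close>, with \<open>H * P\<close> as generalized
    inverse.\<close>
  then have "P' * (P * A * H * (P * A)) = P' * (P * A)"
    by (simp add: P(1))
  moreover have "P' * (P * A * H * (P * A)) = (P' * P) * (A * (H * P) * A)"
    "P' * (P * A) = (P' * P) * A"
    using A H P(2,3) by (simp_all add: assoc_mult_mat_dim)
  ultimately have "A * (H * P) * A = A"
    using A H P(2,3,4) by simp
  with H P show thesis
    by (intro that[of "H * P"]) auto
qed

text \<open>Take a generalized inverse \<open>G\<close> of \<open>A\<^sup>T * A\<close> and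
  \<open>K = G * A\<^sup>T\<close>. Transposing the defining equation of \<open>G\<close> and
  cancelling \<open>A\<^sup>T\<close> on the left gives
  \<open>A * (G\<^sup>T * (A\<^sup>T * A)) = A\<close>, whose transpose is the claim.\<close>

lemma normal_equations_solvable:
  fixes A :: "real mat"
  assumes A: "A \<in> carrier_mat m n"
  obtains K where "K \<in> carrier_mat n m" "A\<^sup>T * A * K = A\<^sup>T"
proof -
  obtain G where G: "G \<in> carrier_mat n n" "A\<^sup>T * A * G * (A\<^sup>T * A) = A\<^sup>T * A"
    using generalized_inverse_exists[of "A\<^sup>T * A" n n] A by auto
  define M where "M = G\<^sup>T * (A\<^sup>T * A) - 1\<^sub>m n"
  have M: "M \<in> carrier_mat n n"
    using A G(1) by (auto simp: M_def)
  have "(A\<^sup>T * A * G * (A\<^sup>T * A))\<^sup>T = (A\<^sup>T * A)\<^sup>T"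
    using G(2) by simp
  then have "A\<^sup>T * (A * (G\<^sup>T * (A\<^sup>T * A))) = A\<^sup>T * A"
    using A G(1) by (simp add: mat_dim_simps)
  then have "A\<^sup>T * (A * M) = 0\<^sub>m n n"
    using A G(1) by (simp add: M_def mat_dim_simps)
  then have "A * M = 0\<^sub>m m n"
    by (rule gram_mult_eq_zero_imp_zero[OF A M])
  then have "A * (G\<^sup>T * (A\<^sup>T * A)) - A = 0\<^sub>m m n"
    using A G(1) by (simp add: M_def mat_dim_simps)
  then have "A * (G\<^sup>T * (A\<^sup>T * A)) = A"
    using minus_mat_eq_zero_iff[of "A * (G\<^sup>T * (A\<^sup>T * A))" m n A] A G(1) by auto
  then have "(A * (G\<^sup>T * (A\<^sup>T * A)))\<^sup>T = A\<^sup>T" by simp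
  then have "A\<^sup>T * A * (G * A\<^sup>T) = A\<^sup>T"
    using A G(1) by (simp add: mat_dim_simps)
  with A G(1) show thesis
    by (intro that[of "G * A\<^sup>T"]) auto
qed

text \<open>The normal equations turn the Gram matrix of \<open>A * K\<close> into
  \<open>(A * K)\<^sup>T\<close>, which is therefore symmetric. Thus \<open>A * K\<close> is the
  orthogonal projection onto the column space of \<open>A\<close>.\<close>

lemma normal_equations_solution:
  fixes A K :: "real mat"
  assumes A: "A \<in> carrier_mat m n" and K: "K \<in> carrier_mat n m" and eq: "A\<^sup>T * A * K = A\<^sup>T"
  shows "(A * K)\<^sup>T = A * K" "A * K * A = A"
proof -
  have "(A * K)\<^sup>T * (A * K) = K\<^sup>T * (A\<^sup>T * A * K)"
    using A K by (simp add: mat_dim_simps)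
  also have "\<dots> = (A * K)\<^sup>T"
    using A K by (simp add: eq mat_dim_simps)
  finally have gram: "(A * K)\<^sup>T * (A * K) = (A * K)\<^sup>T" .
  then have "((A * K)\<^sup>T * (A * K))\<^sup>T = A * K" by simp
  moreover have "((A * K)\<^sup>T * (A * K))\<^sup>T = (A * K)\<^sup>T * (A * K)"
    using transpose_mult_dim[of "(A * K)\<^sup>T" "A * K"] by simp
  ultimately show sym: "(A * K)\<^sup>T = A * K"
    using gram by simp
  have "A * K * A = (A * K)\<^sup>T * A" by (simp only: sym)
  also have "\<dots> = (A\<^sup>T * A * K)\<^sup>T"
    using A K by (simp add: mat_dim_simps)
  finally show "A * K * A = A" by (simp add: eq)
qed

text \<open>Two one-sided solutions are glued: \<open>K\<close> makes \<open>P * K\<close>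
  symmetric, and \<open>L\<close>, from the normal equations of \<open>P\<^sup>T\<close>, makes
  \<open>L * P\<close> symmetric. The product \<open>G = L * P * K\<close> inherits both, as
  \<open>P * G = P * K\<close> and \<open>G * P = L * P\<close>.\<close>

lemma moore_penrose_exists:
  fixes P :: "real mat"
  shows "\<exists>G. is_moore_penrose P G"
proof -
  define m n where "m = dim_row P" and "n = dim_col P"
  have P: "P \<in> carrier_mat m n" by (simp add: m_def n_def)
  obtain K where K: "K \<in> carrier_mat n m" "P\<^sup>T * P * K = P\<^sup>T"
    using normal_equations_solvable[OF P] .
  note PK = normal_equations_solution[OF P K]
  obtain L' where L': "L' \<in> carrier_mat m n" "(P\<^sup>T)\<^sup>T * P\<^sup>T * L' = (P\<^sup>T)\<^sup>T"
    using normal_equations_solvable[of "P\<^sup>T" n m] P by auto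
  note PL' = normal_equations_solution[of "P\<^sup>T", OF _ L']
  define L where "L = L'\<^sup>T"
  have L: "L \<in> carrier_mat n m" using L' by (simp add: L_def)
  have LP: "(L * P)\<^sup>T = L * P" "P * L * P = P"
  proof -
    have "L * P = (P\<^sup>T * L')\<^sup>T"
      using P L'(1) by (simp add: L_def mat_dim_simps)
    then show "(L * P)\<^sup>T = L * P"
      using PL'(1) P by simp
    have "P * L * P = (P\<^sup>T * L' * P\<^sup>T)\<^sup>T"
      using P L'(1) by (simp add: L_def mat_dim_simps)
    then show "P * L * P = P"
      using PL'(2) P by simp
  qed
  define G where "G = L * P * K"
  have G: "G \<in> carrier_mat n m" using L P K by (simp add: G_def)
  have PG: "P * G = P * K"
  proof -
    have "P * G = (P * L * P) * K"
      using P K(1) L by (simp add: G_def mat_dim_simps)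
    then show ?thesis by (simp add: LP)
  qed
  have GP: "G * P = L * P"
  proof -
    have "G * P = L * (P * K * P)"
      using P K(1) L by (simp add: G_def mat_dim_simps)
    then show ?thesis by (simp add: PK)
  qed
  have "G * P * G = L * (P * G)"
    using P L G by (simp add: GP mat_dim_simps)
  also have "\<dots> = G"
    using P K(1) L by (simp add: PG) (simp add: G_def mat_dim_simps)
  finally have "G * P * G = G" .
  then have "is_moore_penrose P G"
    using P G PK LP by (simp add: is_moore_penrose_def PG GP)
  then show ?thesis ..
qed

text \<open>\<open>P * G\<close> and \<open>P * H\<close> are the same orthogonal projection, and so
  are \<open>G * P\<close> and \<open>H * P\<close>; hence
  \<open>G = G * P * G = H * P * H = H\<close>.\<close>

lemma moore_penrose_unique:
  assumes G: "is_moore_penrose P G" and H: "is_moore_penrose P H"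
  shows "G = H"
proof -
  have dims: "dim_row G = dim_col P" "dim_col G = dim_row P"
      "dim_row H = dim_col P" "dim_col H = dim_row P"
    using G H by (auto simp: is_moore_penrose_def)
  have eqs: "P * G * P = P" "G * P * G = G" "(P * G)\<^sup>T = P * G" "(G * P)\<^sup>T = G * P"
      "P * H * P = P" "H * P * H = H" "(P * H)\<^sup>T = P * H" "(H * P)\<^sup>T = H * P"
    using G H by (simp_all add: is_moore_penrose_def)
  have "P * G = (P * H * P) * G" by (simp only: eqs)
  also have "\<dots> = (P * H) * (P * G)"
    using dims by (simp add: assoc_mult_mat_dim)
  \<comment> \<open>Symmetry allows the two projections to be interchanged under one transpose,
    where \<open>P * G * P\<close> collapses to \<open>P\<close>.\<close>
  also have "\<dots> = (P * H)\<^sup>T * (P * G)\<^sup>T"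
    by (simp only: eqs)
  also have "\<dots> = (P * G * P * H)\<^sup>T"
    using dims by (simp add: mat_dim_simps)
  also have "\<dots> = P * H" by (simp only: eqs)
  finally have PGH: "P * G = P * H" .
  have "G * P = G * (P * H * P)" by (simp only: eqs)
  also have "\<dots> = (G * P) * (H * P)"
    using dims by (simp add: assoc_mult_mat_dim)
  also have "\<dots> = (G * P)\<^sup>T * (H * P)\<^sup>T"
    by (simp only: eqs)
  also have "\<dots> = (H * (P * G * P))\<^sup>T"
    using dims by (simp add: mat_dim_simps)
  also have "\<dots> = H * P" by (simp only: eqs)
  finally have GHP: "G * P = H * P" .
  have "G = G * P * G" by (simp only: eqs)
  also have "\<dots> = H * (P * G)" using dims by (simp add: GHP mat_dim_simps)
  also have "\<dots> = H * P * H" using dims by (simp add: PGH mat_dim_simps)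
  also have "\<dots> = H" by (simp only: eqs)
  finally show ?thesis .
qed

lemma moore_penrose: "is_moore_penrose P (moore_penrose P)"
  unfolding moore_penrose_def
  using moore_penrose_exists moore_penrose_unique by (metis theI)


section \<open>Least squares problems\<close>

text \<open>Once one minimizer is known, minimality is a single inequality. It serves both for the
  objective and for the norm among the solutions.\<close>

lemma is_arg_min_iff_le_min:
  fixes f :: "'a \<Rightarrow> 'b::linorder"
  assumes "P x0" "\<And>x. P x \<Longrightarrow> f x0 \<le> f x"
  shows "is_arg_min f P x \<longleftrightarrow> P x \<and> f x \<le> f x0"
  using assms by (auto simp: is_arg_min_linorder intro: order_trans)

text \<open>The residual of \<open>Y0\<close> satisfies the normal equations
  \<open>P\<^sup>T * (P * Y0 - E) = 0\<close>, so it is orthogonal to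
  \<open>P * (Y - Y0)\<close>.\<close>

lemma least_squares_decomposition:
  fixes P E Y :: "real mat"
  assumes P: "P \<in> carrier_mat r k" and E: "E \<in> carrier_mat r d" and Y: "Y \<in> carrier_mat k d"
  defines "Y0 \<equiv> moore_penrose P * E"
  shows "(frobenius_norm (P * Y - E))\<^sup>2 =
    (frobenius_norm (P * (Y - Y0)))\<^sup>2 + (frobenius_norm (P * Y0 - E))\<^sup>2"
proof -
  define G where "G = moore_penrose P"
  have G: "G \<in> carrier_mat k r" and PGP: "P * G * P = P" and sym: "(P * G)\<^sup>T = P * G"
    using moore_penrose[of P] P by (auto simp: is_moore_penrose_def G_def)
  have Y0: "Y0 \<in> carrier_mat k d"
    using G E by (simp add: Y0_def G_def)
  have "P\<^sup>T * (P * G) = P\<^sup>T * (P * G)\<^sup>T"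
    by (simp only: sym)
  also have "\<dots> = (P * G * P)\<^sup>T"
    using P G by (intro transpose_mult_dim[symmetric]) auto
  finally have "P\<^sup>T * (P * G) = (P * G * P)\<^sup>T" .
  then have normal: "P\<^sup>T * (P * G) = P\<^sup>T"
    by (simp add: PGP)
  have "P\<^sup>T * (P * Y0 - E) = P\<^sup>T * (P * G) * E - P\<^sup>T * E"
    using P E G by (simp add: Y0_def mat_dim_simps flip: G_def)
  also have "\<dots> = 0\<^sub>m k d"
    using P E by (simp add: normal)
  finally have res: "P\<^sup>T * (P * Y0 - E) = 0\<^sub>m k d" .
  have "(P * (Y - Y0))\<^sup>T * (P * Y0 - E) = (Y - Y0)\<^sup>T * (P\<^sup>T * (P * Y0 - E))"
    using P E Y Y0 by (simp add: transpose_mult_dim assoc_mult_mat_dim)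
  also have "\<dots> = 0\<^sub>m d d"
    using Y Y0 by (simp add: res right_mult_zero_mat[of _ d k])
  finally have orth: "(P * (Y - Y0))\<^sup>T * (P * Y0 - E) = 0\<^sub>m d d" .
  have "P * Y - E = P * (Y - Y0) + (P * Y0 - E)"
  proof -
    have "P * (Y - Y0) = P * Y - P * Y0"
      using P Y Y0 by (simp add: mat_dim_simps)
    then show ?thesis
      by (intro eq_matI) (use P Y Y0 E in auto)
  qed
  then show ?thesis
    using frobenius_norm_pythagoras[OF _ _ orth, of r] P E Y Y0
    by (simp add: minus_carrier_mat)
qed

text \<open>The columns of \<open>Y0\<close> lie in the row space of \<open>P\<close>, because
  \<open>G\<^sup>T = G\<^sup>T * (G * P)\<close>; those of \<open>Y - Y0\<close> lie in the kernel
  of \<open>P\<close>, which is orthogonal to it.\<close>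

lemma least_squares_norm_decomposition:
  fixes P E Y :: "real mat"
  assumes P: "P \<in> carrier_mat r k" and E: "E \<in> carrier_mat r d" and Y: "Y \<in> carrier_mat k d"
  defines "Y0 \<equiv> moore_penrose P * E"
  assumes ker: "P * (Y - Y0) = 0\<^sub>m r d"
  shows "(frobenius_norm Y)\<^sup>2 = (frobenius_norm Y0)\<^sup>2 + (frobenius_norm (Y - Y0))\<^sup>2"
proof -
  define G where "G = moore_penrose P"
  have G: "G \<in> carrier_mat k r" and GPG: "G * P * G = G" and sym: "(G * P)\<^sup>T = G * P"
    using moore_penrose[of P] P by (auto simp: is_moore_penrose_def G_def)
  have Y0: "Y0 \<in> carrier_mat k d"
    using G E by (simp add: Y0_def G_def)
  have "G\<^sup>T = (G * P * G)\<^sup>T"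
    by (simp only: GPG)
  also have "\<dots> = G\<^sup>T * (G * P)\<^sup>T"
    using P G by (intro transpose_mult_dim) auto
  finally have GT: "G\<^sup>T = G\<^sup>T * (G * P)"
    by (simp only: sym)
  have "Y0\<^sup>T * (Y - Y0) = E\<^sup>T * (G\<^sup>T * (Y - Y0))"
    using E G Y Y0 unfolding Y0_def G_def[symmetric]
    by (simp add: transpose_mult_dim assoc_mult_mat_dim)
  also have "G\<^sup>T * (Y - Y0) = G\<^sup>T * (G * P) * (Y - Y0)"
    by (simp only: GT[symmetric])
  also have "\<dots> = G\<^sup>T * (G * (P * (Y - Y0)))"
    using P G Y Y0 by (simp add: assoc_mult_mat_dim)
  also have "E\<^sup>T * \<dots> = 0\<^sub>m d d"
    using E G by (simp add: ker)
  finally have orth: "Y0\<^sup>T * (Y - Y0) = 0\<^sub>m d d" .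
  have "Y0 + (Y - Y0) = Y"
    by (rule eq_matI) (use Y Y0 in auto)
  then show ?thesis
    using frobenius_norm_pythagoras[OF Y0 _ orth] Y Y0
    by (simp add: minus_carrier_mat)
qed

section \<open>Elimination of the equality constraint\<close>

text \<open>In the coordinates \<open>Q\<^sup>T X\<close> the constraint fixes the upper block and leaves the lower
  one free.\<close>

lemma lse_feasible_iff:
  fixes C D Q R X :: "real mat"
  assumes C: "C \<in> carrier_mat q n" and D: "D \<in> carrier_mat q d" and q: "q \<le> n"
    and Q: "Q \<in> carrier_mat n n" "orthogonal_real_mat Q"
    and R: "R \<in> carrier_mat q q" "invertible_mat R"
    and QR: "C\<^sup>T = Q * (R @\<^sub>r 0\<^sub>m (n - q) q)"
  shows "X \<in> carrier_mat n d \<and> C * X = D \<longleftrightarrow>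
    (\<exists>Z \<in> carrier_mat (n - q) d. X = Q * (inv_mat (R\<^sup>T) * D @\<^sub>r Z))"
proof -
  have QQ: "Q\<^sup>T * Q = 1\<^sub>m n" "Q * Q\<^sup>T = 1\<^sub>m n"
    using Q by (auto simp: orthogonal_real_mat_def inverts_mat_def)
  have RT: "R\<^sup>T \<in> carrier_mat q q" using R by simp
  note Rinv = inv_mat_mult[OF RT invertible_mat_transpose[OF R(2)]]
  have "C = (Q * (R @\<^sub>r 0\<^sub>m (n - q) q))\<^sup>T"
    by (simp flip: QR)
  then have C_eq: "C = (R @\<^sub>r 0\<^sub>m (n - q) q)\<^sup>T * Q\<^sup>T"
    using Q R q by (simp add: transpose_mult_dim)
  \<comment> \<open>Orthogonality cancels \<open>Q\<close>, and the zero block below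
    \<open>R\<close> annihilates \<open>Z\<close>.\<close>
  have C_mult: "C * (Q * (Y @\<^sub>r Z)) = R\<^sup>T * Y"
    if "Y \<in> carrier_mat q d" "Z \<in> carrier_mat (n - q) d" for Y Z
  proof -
    have "C * (Q * (Y @\<^sub>r Z)) = (R @\<^sub>r 0\<^sub>m (n - q) q)\<^sup>T * ((Q\<^sup>T * Q) * (Y @\<^sub>r Z))"
      unfolding C_eq using that Q R q by (simp add: assoc_mult_mat_dim)
    also have "(Q\<^sup>T * Q) * (Y @\<^sub>r Z) = Y @\<^sub>r Z"
      using that q carrier_append_rows[OF that] by (simp add: QQ)
    also have "(R @\<^sub>r 0\<^sub>m (n - q) q)\<^sup>T * (Y @\<^sub>r Z) = R\<^sup>T * Y"
      using that R append_rows_transpose_mult[OF R(1) zero_carrier_mat that] by simp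
    finally show ?thesis .
  qed
  show ?thesis
  proof
    assume X: "X \<in> carrier_mat n d \<and> C * X = D"
    \<comment> \<open>By \<open>q \<le> n\<close> the truncated subtraction is exact, so the
      \<open>n\<close> rows can be cut after row \<open>q\<close>.\<close>
    then have "Q\<^sup>T * X \<in> carrier_mat (q + (n - q)) d"
      using Q q by auto
    then obtain Y Z where YZ: "Y \<in> carrier_mat q d" "Z \<in> carrier_mat (n - q) d" "Q\<^sup>T * X = Y @\<^sub>r Z"
      by (rule append_rows_split)
    have "Q * (Q\<^sup>T * X) = (Q * Q\<^sup>T) * X"
      using X Q by (auto simp: assoc_mult_mat_dim)
    then have X_eq: "X = Q * (Y @\<^sub>r Z)"
      using X YZ by (auto simp: QQ)
    then have "R\<^sup>T * Y = D"
      using X C_mult YZ by auto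
    then have "inv_mat (R\<^sup>T) * D = (inv_mat (R\<^sup>T) * R\<^sup>T) * Y"
      using Rinv(1) RT YZ by (auto simp: assoc_mult_mat_dim)
    then have "inv_mat (R\<^sup>T) * D = Y"
      using Rinv YZ by simp
    then show "\<exists>Z \<in> carrier_mat (n - q) d. X = Q * (inv_mat (R\<^sup>T) * D @\<^sub>r Z)"
      using X_eq YZ by auto
  next
    assume "\<exists>Z \<in> carrier_mat (n - q) d. X = Q * (inv_mat (R\<^sup>T) * D @\<^sub>r Z)"
    then obtain Z where Z: "Z \<in> carrier_mat (n - q) d" "X = Q * (inv_mat (R\<^sup>T) * D @\<^sub>r Z)"
      by auto
    have Y: "inv_mat (R\<^sup>T) * D \<in> carrier_mat q d"
      using Rinv D by simp
    have "C * X = (R\<^sup>T * inv_mat (R\<^sup>T)) * D"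
      using C_mult[OF Y Z(1)] Z Rinv(1) RT D by (auto simp: assoc_mult_mat_dim)
    then have "C * X = D"
      using Rinv D by simp
    moreover have "X \<in> carrier_mat n d"
      using carrier_append_rows[OF Y Z(1)] Z Q q by simp
    ultimately show "X \<in> carrier_mat n d \<and> C * X = D" by simp
  qed
qed

text \<open>The map \<open>\<phi>\<close> parametrizes the feasible set by the free block
  \<open>Z\<close>, and the candidate is \<open>\<phi> Z0\<close>. The equivalence contains
  existence and uniqueness along with the formula.\<close>

lemma lse_min_norm_solution:
  fixes A B C D Q R P1 P2 X :: "real mat"
  assumes A: "A \<in> carrier_mat r n" and B: "B \<in> carrier_mat r d"
    and C: "C \<in> carrier_mat q n" and D: "D \<in> carrier_mat q d" and q: "q \<le> n"
    and Q: "Q \<in> carrier_mat n n" "orthogonal_real_mat Q"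
    and R: "R \<in> carrier_mat q q" "invertible_mat R"
    and QR: "C\<^sup>T = Q * (R @\<^sub>r 0\<^sub>m (n - q) q)"
    and P1: "P1 \<in> carrier_mat r q" and P2: "P2 \<in> carrier_mat r (n - q)"
    and partition: "A * Q = P1 @\<^sub>c P2"
  shows "is_arg_min frobenius_norm (lse_solution A B C D) X \<longleftrightarrow>
    X = Q * (inv_mat (R\<^sup>T) * D @\<^sub>r moore_penrose P2 * (B - P1 * inv_mat (R\<^sup>T) * D))"
proof -
  define Y where "Y = inv_mat (R\<^sup>T) * D"
  \<comment> \<open>What remains to be approximated by \<open>P2 * Z\<close> after the constraint
    has fixed \<open>Y\<close>.\<close>
  define E where "E = B - P1 * Y"
  define Z0 where "Z0 = moore_penrose P2 * E"
  define \<phi> where "\<phi> Z = Q * (Y @\<^sub>r Z)" for Z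
  have QQ: "Q\<^sup>T * Q = 1\<^sub>m n"
    using Q by (auto simp: orthogonal_real_mat_def inverts_mat_def)
  have Rinv: "inv_mat (R\<^sup>T) \<in> carrier_mat q q"
    using inv_mat_mult(1)[OF _ invertible_mat_transpose[OF R(2)]] R(1) by simp
  have Y: "Y \<in> carrier_mat q d"
    using Rinv D by (simp add: Y_def)
  have E: "E \<in> carrier_mat r d"
    using B P1 Y by (simp add: E_def minus_carrier_mat)
  have Z0: "Z0 \<in> carrier_mat (n - q) d"
    using moore_penrose[of P2] P2 E by (auto simp: is_moore_penrose_def Z0_def)
  have YZ: "Y @\<^sub>r Z \<in> carrier_mat n d" if "Z \<in> carrier_mat (n - q) d" for Z
    using carrier_append_rows[OF Y that] q by simp
  have feas: "X \<in> carrier_mat n d \<and> C * X = D \<longleftrightarrow> (\<exists>Z \<in> carrier_mat (n - q) d. X = \<phi> Z)" for X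
    unfolding \<phi>_def Y_def by (rule lse_feasible_iff[OF C D q Q R QR])
  have obj: "(frobenius_norm (A * \<phi> Z - B))\<^sup>2 =
      (frobenius_norm (P2 * (Z - Z0)))\<^sup>2 + (frobenius_norm (P2 * Z0 - E))\<^sup>2"
    if Z: "Z \<in> carrier_mat (n - q) d" for Z
  proof -
    have "A * \<phi> Z = A * Q * (Y @\<^sub>r Z)"
      using A Q YZ[OF Z] by (simp add: \<phi>_def assoc_mult_mat_dim)
    also have "\<dots> = P1 * Y + P2 * Z"
      unfolding partition by (rule append_cols_mult_append_rows[OF P1 P2 Y Z])
    finally have AZ: "A * \<phi> Z = P1 * Y + P2 * Z" .
    have "A * \<phi> Z - B = P2 * Z - E"
      unfolding AZ E_def by (rule eq_matI) (use P1 P2 Y Z B in auto)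
    then show ?thesis
      using least_squares_decomposition[OF P2 E Z] by (simp add: Z0_def)
  qed
  have obj_Z0: "(frobenius_norm (A * \<phi> Z0 - B))\<^sup>2 = (frobenius_norm (P2 * Z0 - E))\<^sup>2"
  proof -
    have "P2 * (Z0 - Z0) = 0\<^sub>m r d"
      using P2 Z0 by (simp add: mat_dim_simps)
    then show ?thesis
      using obj[OF Z0] frobenius_norm_eq_0_iff[of "0\<^sub>m r d :: real mat" r d] by simp
  qed
  \<comment> \<open>By \<open>obj\<close>, the squared objective at \<open>\<phi> Z\<close> exceeds
    that at \<open>\<phi> Z0\<close> by the squared norm of \<open>P2 * (Z - Z0)\<close>.\<close>
  have sol: "lse_solution A B C D X \<longleftrightarrow>
      (\<exists>Z \<in> carrier_mat (n - q) d. X = \<phi> Z \<and> P2 * (Z - Z0) = 0\<^sub>m r d)" for X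
  proof -
    have carr: "dim_col A = n" "dim_col B = d" using A B by auto
    have "lse_solution A B C D X \<longleftrightarrow> (X \<in> carrier_mat n d \<and> C * X = D) \<and>
        frobenius_norm (A * X - B) \<le> frobenius_norm (A * \<phi> Z0 - B)"
      unfolding lse_solution_def carr
    proof (rule is_arg_min_iff_le_min)
      show "\<phi> Z0 \<in> carrier_mat n d \<and> C * \<phi> Z0 = D"
        using feas Z0 by blast
      show "frobenius_norm (A * \<phi> Z0 - B) \<le> frobenius_norm (A * X - B)"
        if "X \<in> carrier_mat n d \<and> C * X = D" for X
        using that[unfolded feas] obj obj_Z0 by (auto simp: frobenius_norm_le_iff)
    qed
    also have "\<dots> \<longleftrightarrow> (\<exists>Z \<in> carrier_mat (n - q) d. X = \<phi> Z \<and>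
        frobenius_norm (A * \<phi> Z - B) \<le> frobenius_norm (A * \<phi> Z0 - B))"
      unfolding feas by blast
    also have "\<dots> \<longleftrightarrow> (\<exists>Z \<in> carrier_mat (n - q) d. X = \<phi> Z \<and> P2 * (Z - Z0) = 0\<^sub>m r d)"
    proof (intro bex_cong refl conj_cong)
      fix Z :: "real mat" assume Z: "Z \<in> carrier_mat (n - q) d"
      show "frobenius_norm (A * \<phi> Z - B) \<le> frobenius_norm (A * \<phi> Z0 - B) \<longleftrightarrow>
          P2 * (Z - Z0) = 0\<^sub>m r d"
        using obj[OF Z] obj_Z0 frobenius_norm_eq_0_iff[of "P2 * (Z - Z0)" r d] P2 Z Z0
        by (simp add: frobenius_norm_le_iff minus_carrier_mat)
    qed
    finally show ?thesis .
  qed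
  have norm_phi: "(frobenius_norm (\<phi> Z))\<^sup>2 = (frobenius_norm Y)\<^sup>2 + (frobenius_norm Z)\<^sup>2"
    if "Z \<in> carrier_mat (n - q) d" for Z
    using frobenius_norm_orthogonal_mult[OF Q(1) QQ YZ[OF that]] frobenius_norm_append_rows[OF Y that]
    by (simp add: \<phi>_def)
  \<comment> \<open>The block \<open>Y\<close> contributes the same amount to both norms, so only
    the lower blocks are compared.\<close>
  have norm_sol: "(frobenius_norm (\<phi> Z))\<^sup>2 =
      (frobenius_norm (\<phi> Z0))\<^sup>2 + (frobenius_norm (Z - Z0))\<^sup>2"
    if "Z \<in> carrier_mat (n - q) d" "P2 * (Z - Z0) = 0\<^sub>m r d" for Z
    using least_squares_norm_decomposition[OF P2 E that(1)] that(2) norm_phi[OF that(1)] norm_phi[OF Z0]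
    by (simp add: Z0_def)
  have sol_Z0: "lse_solution A B C D (\<phi> Z0)"
    unfolding sol using P2 Z0 by (intro bexI[of _ Z0]) (auto simp: mat_dim_simps)
  have "is_arg_min frobenius_norm (lse_solution A B C D) X \<longleftrightarrow>
      lse_solution A B C D X \<and> frobenius_norm X \<le> frobenius_norm (\<phi> Z0)"
  proof (rule is_arg_min_iff_le_min)
    show "lse_solution A B C D (\<phi> Z0)" by (rule sol_Z0)
    fix X assume "lse_solution A B C D X"
    then show "frobenius_norm (\<phi> Z0) \<le> frobenius_norm X"
      unfolding sol using norm_sol by (auto simp: frobenius_norm_le_iff)
  qed
  also have "\<dots> \<longleftrightarrow> X = \<phi> Z0"
  proof
    assume X: "lse_solution A B C D X \<and> frobenius_norm X \<le> frobenius_norm (\<phi> Z0)"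
    then obtain Z where Z: "Z \<in> carrier_mat (n - q) d" "X = \<phi> Z" "P2 * (Z - Z0) = 0\<^sub>m r d"
      unfolding sol by blast
    have "frobenius_norm (Z - Z0) = 0"
      using X norm_sol[OF Z(1,3)] by (simp add: Z(2) frobenius_norm_le_iff)
    then have "Z = Z0"
      using frobenius_norm_eq_0_iff[of "Z - Z0" "n - q" d] minus_mat_eq_zero_iff[OF Z(1) Z0] Z0
      by (simp add: minus_carrier_mat)
    then show "X = \<phi> Z0" by (simp add: Z)
  qed (use sol_Z0 in simp)
  also have "\<phi> Z0 = Q * (inv_mat (R\<^sup>T) * D @\<^sub>r moore_penrose P2 * (B - P1 * inv_mat (R\<^sup>T) * D))"
    using P1 Rinv D by (simp add: \<phi>_def Z0_def E_def Y_def assoc_mult_mat_dim)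
  finally show ?thesis .
qed


section \<open>The real representation\<close>

lemma Rb_sum:
  "Rb0 (sum f S) = (\<Sum>x\<in>S. Rb0 (f x))" "Rb1 (sum f S) = (\<Sum>x\<in>S. Rb1 (f x))"
  "Rb2 (sum f S) = (\<Sum>x\<in>S. Rb2 (f x))" "Rb3 (sum f S) = (\<Sum>x\<in>S. Rb3 (f x))"
  by (induction S rule: infinite_finite_induct; simp add: zero_rbq_def plus_rbq_def)+

text \<open>A real factor does not mix the four components; here the restriction to real
  \<open>X\<close> enters.\<close>

lemma Rb_mult_of_real:
  "Rb0 (x * of_real r) = Rb0 x * r" "Rb1 (x * of_real r) = Rb1 x * r"
  "Rb2 (x * of_real r) = Rb2 x * r" "Rb3 (x * of_real r) = Rb3 x * r"
  by (simp_all add: of_real_def one_rbq_def scaleR_rbq_def times_rbq_def)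

lemma real_rep_col_mult:
  assumes M: "M \<in> carrier_mat m n" and X: "X \<in> carrier_mat n d"
  shows "real_rep_col (M * rbq_of_real_mat X) = real_rep_col M * X"
proof -
  have "map_mat Rb0 (M * rbq_of_real_mat X) = map_mat Rb0 M * X"
    "map_mat Rb1 (M * rbq_of_real_mat X) = map_mat Rb1 M * X"
    "map_mat Rb2 (M * rbq_of_real_mat X) = map_mat Rb2 M * X"
    "map_mat Rb3 (M * rbq_of_real_mat X) = map_mat Rb3 M * X"
    by (rule eq_matI; use M X in \<open>simp add: scalar_prod_def Rb_sum Rb_mult_of_real\<close>)+
  then show ?thesis
    unfolding real_rep_col_def using M X
    \<comment> \<open>The stack is nested to the right, so each instance peels off one block of
      \<open>m\<close> rows.\<close>
    by (simp add: append_rows_mult[of _ m n _ "m + (m + m)"] append_rows_mult[of _ m n _ "m + m"]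
        append_rows_mult[of _ m n _ m])
qed

lemma real_rep_col_minus:
  assumes M: "M \<in> carrier_mat m n" and N: "N \<in> carrier_mat m n"
  shows "real_rep_col (M - N) = real_rep_col M - real_rep_col N"
proof -
  have "map_mat Rb0 (M - N) = map_mat Rb0 M - map_mat Rb0 N"
    "map_mat Rb1 (M - N) = map_mat Rb1 M - map_mat Rb1 N"
    "map_mat Rb2 (M - N) = map_mat Rb2 M - map_mat Rb2 N"
    "map_mat Rb3 (M - N) = map_mat Rb3 M - map_mat Rb3 N"
    by (rule eq_matI; use M N in \<open>simp add: minus_rbq_def\<close>)+
  then show ?thesis
    unfolding real_rep_col_def using M N
    by (simp add: append_rows_minus[of _ m n _ _ "m + (m + m)"]
        append_rows_minus[of _ m n _ _ "m + m"] append_rows_minus[of _ m n _ _ m])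
qed

lemma real_rep_col_inject:
  assumes M: "M \<in> carrier_mat m n" and N: "N \<in> carrier_mat m n"
  shows "real_rep_col M = real_rep_col N \<longleftrightarrow> M = N"
proof -
  have "real_rep_col M = real_rep_col N \<longleftrightarrow> map_mat Rb0 M = map_mat Rb0 N \<and>
      map_mat Rb1 M = map_mat Rb1 N \<and> map_mat Rb2 M = map_mat Rb2 N \<and> map_mat Rb3 M = map_mat Rb3 N"
    unfolding real_rep_col_def using M N
    by (simp add: append_rows_inject[of _ m n _ _ "m + (m + m)"]
        append_rows_inject[of _ m n _ _ "m + m"] append_rows_inject[of _ m n _ _ m])
  also have "\<dots> \<longleftrightarrow> M = N"
    using M N by (auto simp: mat_eq_iff rbq_eq_iff)
  finally show ?thesis .
qed

text \<open>The squared norm of an entry is the sum of its four squared components, which the stack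
  merely distributes over four blocks.\<close>

lemma frobenius_norm_real_rep_col: "frobenius_norm (real_rep_col M) = frobenius_norm M"
proof -
  define m n where "m = dim_row M" and "n = dim_col M"
  have M: "M \<in> carrier_mat m n" by (simp add: m_def n_def)
  have "(frobenius_norm (real_rep_col M))\<^sup>2 =
      (frobenius_norm (map_mat Rb0 M))\<^sup>2 + ((frobenius_norm (map_mat Rb1 M))\<^sup>2 +
       ((frobenius_norm (map_mat Rb2 M))\<^sup>2 + (frobenius_norm (map_mat Rb3 M))\<^sup>2))"
    unfolding real_rep_col_def using M
    by (simp add: frobenius_norm_append_rows[of _ m n _ "m + (m + m)"]
        frobenius_norm_append_rows[of _ m n _ "m + m"] frobenius_norm_append_rows[of _ m n _ m])
  also have "\<dots> = (frobenius_norm M)\<^sup>2"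
    using M by (simp add: frobenius_norm_sq norm_rbq_def sum.distrib)
  finally show ?thesis
    by (simp add: frobenius_norm_nonneg power2_eq_iff_nonneg)
qed

text \<open>An equation between predicates, so that it also rewrites the minimum norm problem, which
  takes the solution predicate as an argument.\<close>

lemma rblse_solution_eq_lse_solution:
  assumes A: "A \<in> carrier_mat m n" and B: "B \<in> carrier_mat m d"
    and C: "C \<in> carrier_mat p n" and D: "D \<in> carrier_mat p d"
  shows "rblse_solution A B C D =
    lse_solution (real_rep_col A) (real_rep_col B) (real_rep_col C) (real_rep_col D)"
proof -
  have carr: "dim_col A = n" "dim_col B = d"
      "dim_col (real_rep_col A) = n" "dim_col (real_rep_col B) = d"
    using A B carrier_matD(2)[OF real_rep_col_carrier[OF A]]
      carrier_matD(2)[OF real_rep_col_carrier[OF B]] by auto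
  have "frobenius_norm (A * rbq_of_real_mat X - B) =
      frobenius_norm (real_rep_col A * X - real_rep_col B)"
    and "C * rbq_of_real_mat X = D \<longleftrightarrow> real_rep_col C * X = real_rep_col D"
    if X: "X \<in> carrier_mat n d" for X
  proof -
    have "real_rep_col (A * rbq_of_real_mat X - B) = real_rep_col A * X - real_rep_col B"
      using A B X by (simp add: real_rep_col_minus[of _ m d] real_rep_col_mult)
    then show "frobenius_norm (A * rbq_of_real_mat X - B) =
        frobenius_norm (real_rep_col A * X - real_rep_col B)"
      by (metis frobenius_norm_real_rep_col)
    show "C * rbq_of_real_mat X = D \<longleftrightarrow> real_rep_col C * X = real_rep_col D"
      using real_rep_col_inject[of "C * rbq_of_real_mat X" p d D] real_rep_col_mult[OF C X] C D X
      by auto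
  qed
  \<comment> \<open>The two facts assume the dimensions of \<open>X\<close>; this suffices because
    \<open>is_arg_min\<close> compares the objective at feasible points only.\<close>
  then show ?thesis
    unfolding rblse_solution_def lse_solution_def carr is_arg_min_def fun_eq_iff by metis
qed

theorem theorem3p1:
  fixes m n d p :: nat
    and A B C D :: "rbq mat"
    and Q R P1 P2 :: "real mat"
  assumes A: "A \<in> carrier_mat m n"
    and B: "B \<in> carrier_mat m d"
    and C: "C \<in> carrier_mat p n"
    and D: "D \<in> carrier_mat p d"
    and dims: "m \<ge> n + d"
    and full_rank: "full_row_rank (real_rep_col C)"
    and Q: "Q \<in> carrier_mat n n" "orthogonal_real_mat Q"
    and R: "R \<in> carrier_mat (4 * p) (4 * p)" "invertible_mat R" "upper_triangular R"
    and QR: "(real_rep_col C)\<^sup>T = Q * (R @\<^sub>r 0\<^sub>m (n - 4 * p) (4 * p))"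
    and P1: "P1 \<in> carrier_mat (4 * m) (4 * p)"
    and P2: "P2 \<in> carrier_mat (4 * m) (n - 4 * p)"
    and partition: "real_rep_col A * Q = P1 @\<^sub>c P2"
  shows "(\<forall>X \<in> carrier_mat n d.
            rblse_solution A B C D X \<longleftrightarrow>
            lse_solution (real_rep_col A) (real_rep_col B) (real_rep_col C) (real_rep_col D) X)
       \<and> (\<forall>X. is_arg_min frobenius_norm (rblse_solution A B C D) X \<longleftrightarrow>
            X = Q * (inv_mat (R\<^sup>T) * real_rep_col D
                     @\<^sub>r moore_penrose P2
                         * (real_rep_col B - P1 * inv_mat (R\<^sup>T) * real_rep_col D)))"
proof -
  \<comment> \<open>The rank equals the number of rows \<open>4 * p\<close> and is at most the
    number of columns \<open>n\<close>, so \<open>n - 4 * p\<close> is a genuine difference.\<close>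
  have "4 * p \<le> n"
    using full_rank carrier_matD(1)[OF real_rep_col_carrier[OF C]]
      vec_space.rank_le_nc[OF real_rep_col_carrier[OF C]]
    by (simp add: full_row_rank_def)
  note min_norm = lse_min_norm_solution[OF real_rep_col_carrier[OF A] real_rep_col_carrier[OF B]
      real_rep_col_carrier[OF C] real_rep_col_carrier[OF D] this Q R(1,2) QR P1 P2 partition]
  show ?thesis
    unfolding rblse_solution_eq_lse_solution[OF A B C D] using min_norm by blast
qed

end
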